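(* Let $n\ge 2$ and let $\bm X=(X_1,\dots,X_n)$ and $Y$ be jointly distributed random variables taking values in finite alphabets. Then $$\mathrm{RSI}(\bm X;Y)=\Omega(\bm X,Y)-\Omega(\bm X\mid Y),$$ where $\Omega(\bm X,Y)$ is the O-information of the $(n+1)$-component vector $(X_1,\dots,X_n,Y)$.
   Context: $H$ denotes Shannon entropy and $I$ Shannon mutual information. For a random vector $\bm Z=(Z_1,\dots,Z_k)$, write $\bm Z_{-j}$ for the vector obtained by deleting $Z_j$. The O-information is $$\Omega(\bm Z)=(k-2)H(\bm Z)+\sum_{j=1}^k\big(H(Z_j)-H(\bm Z_{-j})\big).$$ The redundancy-synergy index is $$\mathrm{RSI}(\bm X;Y)=\sum_{j=1}^n I(X_j;Y)-I(\bm X;Y).$$ The conditional quantity $\Omega(\bm X\mid Y)$ is the average over $y\sim Y$ of the O-information of the conditional law of $\bm X$ given $Y=y$; equivalently, it is given by the formula for $\Omega(\bm X)$ with every entropy replaced by the corresponding entropy conditional on $Y$. *)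

theory Defs
  imports "HOL-Probability.Information"
begin

text \<open>
  A random vector is a family \<open>Z\<close> of random variables on \<open>M\<close> with indices from \<open>1\<close> on.
  Its components share one value type, but each may have its own alphabet inside that type.
  Entropies are Shannon entropies to base \<open>b\<close>.
\<close>

abbreviation shannon_entropy :: "real \<Rightarrow> 'a measure \<Rightarrow> ('a \<Rightarrow> 'c) \<Rightarrow> real" where
  "shannon_entropy b M Z \<equiv> prob_space.entropy M b (count_space (Z ` space M)) Z"

abbreviation shannon_mutual_information ::
  "real \<Rightarrow> 'a measure \<Rightarrow> ('a \<Rightarrow> 'c) \<Rightarrow> ('a \<Rightarrow> 'd) \<Rightarrow> real" where
  "shannon_mutual_information b M Z W \<equiv>
    prob_space.mutual_information M b
      (count_space (Z ` space M)) (count_space (W ` space M)) Z W"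

definition subvector :: "nat set \<Rightarrow> (nat \<Rightarrow> 'a \<Rightarrow> 'v) \<Rightarrow> 'a \<Rightarrow> nat \<Rightarrow> 'v" where
  "subvector J Z = (\<lambda>\<omega>. \<lambda>j\<in>J. Z j \<omega>)"

definition o_information :: "real \<Rightarrow> 'a measure \<Rightarrow> nat \<Rightarrow> (nat \<Rightarrow> 'a \<Rightarrow> 'v) \<Rightarrow> real" where
  "o_information b M k Z =
    (real k - 2) * shannon_entropy b M (subvector {1..k} Z) +
    (\<Sum>j=1..k. shannon_entropy b M (Z j) -
                shannon_entropy b M (subvector ({1..k} - {j}) Z))"

definition rsi ::
  "real \<Rightarrow> 'a measure \<Rightarrow> nat \<Rightarrow> (nat \<Rightarrow> 'a \<Rightarrow> 'v) \<Rightarrow> ('a \<Rightarrow> 'w) \<Rightarrow> real" where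
  "rsi b M n X Y =
    (\<Sum>j=1..n. shannon_mutual_information b M (X j) Y) -
    shannon_mutual_information b M (subvector {1..n} X) Y"

text \<open>
  \<open>uniform_measure M A\<close> is \<open>M\<close> conditioned on the event \<open>A\<close>.  Values \<open>y\<close> of probability
  zero contribute nothing to the average below, since their weight is \<open>0\<close>.
\<close>

definition cond_o_information ::
  "real \<Rightarrow> 'a measure \<Rightarrow> nat \<Rightarrow> (nat \<Rightarrow> 'a \<Rightarrow> 'v) \<Rightarrow> ('a \<Rightarrow> 'w) \<Rightarrow> real" where
  "cond_o_information b M n X Y =
    (\<Sum>y\<in>Y ` space M.
      measure M (Y -` {y} \<inter> space M) *
      o_information b (uniform_measure M (Y -` {y} \<inter> space M)) n X)"

end

theory Submission
  imports Defs
begin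

text \<open>
  By the chain rule \<open>H(Y, Z) = H(Y) + H(Z | Y)\<close> and \<open>I(Z; Y) = H(Z) - H(Z | Y)\<close>, both sides
  become linear combinations of \<open>H(Y)\<close> and of the entropies, plain and conditional on \<open>Y\<close>, of
  subvectors of \<open>X\<close>.  In \<open>\<Omega>(X, Y)\<close> the term that deletes \<open>Y\<close> contributes \<open>H(Y) - H(X)\<close>,
  the coefficients of \<open>H(Y)\<close> cancel, and what is left agrees term by term.
\<close>

lemma simple_function_subvector:
  assumes "finite J" and Z: "\<And>j. j \<in> J \<Longrightarrow> simple_function M (Z j)"
  shows "simple_function M (subvector J Z)"
  using assms
proof (induction J)
  case empty
  then show ?case by (simp add: subvector_def)
next
  case (insert i J)
  \<comment> \<open>Overwriting position \<open>i\<close> of the vector over \<open>J\<close> gives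
    the vector over \<open>insert i J\<close>, so the larger subvector is a function of a pair of
    simple functions.\<close>
  have "simple_function M ((\<lambda>(z, v). v(i := z)) \<circ> (\<lambda>\<omega>. (Z i \<omega>, subvector J Z \<omega>)))"
    using insert by (intro simple_function_compose simple_function_Pair) auto
  also have "(\<lambda>(z, v). v(i := z)) \<circ> (\<lambda>\<omega>. (Z i \<omega>, subvector J Z \<omega>)) = subvector (insert i J) Z"
    by (auto simp: subvector_def fun_eq_iff restrict_def)
  finally show ?case .
qed

lemma simple_function_uniform_measure [simp]:
  "simple_function (uniform_measure M A) Z \<longleftrightarrow> simple_function M Z"
  by (simp add: simple_function_def)

lemma (in information_space) entropy_sum:
  assumes "simple_function M Z"
  shows "\<H>(Z) = - (\<Sum>z\<in>Z ` space M. prob (Z -` {z} \<inter> space M) * log b (prob (Z -` {z} \<inter> space M)))"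
  by (rule entropy_simple_distributed[OF simple_distributedI[OF assms measure_nonneg refl]])

text \<open>Given \<open>Y = y\<close>, the law of \<open>Z\<close> has weights
  \<open>q (z, y) / p y\<close>, with \<open>q\<close> and \<open>p\<close> the point probabilities
  of \<open>(Z, Y)\<close> and \<open>Y\<close>. Its entropy times \<open>p y\<close> is the part of
  the double sum for \<open>\<H>(Z | Y)\<close> that lies over \<open>y\<close>.\<close>

lemma (in information_space) conditional_entropy_eq_average:
  assumes Z: "simple_function M Z" and Y: "simple_function M Y"
  shows "\<H>(Z | Y) =
    (\<Sum>y\<in>Y ` space M. prob (Y -` {y} \<inter> space M) *
      shannon_entropy b (uniform_measure M (Y -` {y} \<inter> space M)) Z)"
proof -
  define p where "p y = prob (Y -` {y} \<inter> space M)" for y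
  define q where "q w = prob ((\<lambda>\<omega>. (Z \<omega>, Y \<omega>)) -` {w} \<inter> space M)" for w
  define h where "h y = shannon_entropy b (uniform_measure M (Y -` {y} \<inter> space M)) Z" for y
  note ZY = simple_function_Pair[OF Z Y]
  have fibre: "p y * h y = - (\<Sum>z\<in>Z ` space M. q (z, y) * log b (q (z, y) / p y))"
    if y: "y \<in> Y ` space M" for y
  proof (cases "p y = 0")
    case True
    \<comment> \<open>Conditioning on a null event yields no probability space, so nothing is said
      about \<open>h y\<close> here; both sides vanish, the left by its factor \<open>p y\<close>,
      the right because every \<open>q (z, y)\<close> is 0.\<close>
    have "q (z, y) \<le> p y" for z
      unfolding p_def q_def
      using simple_functionD(2)[OF Y] by (intro finite_measure_mono) auto
    then have "q (z, y) = 0" for z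
      using True measure_nonneg[of M] by (metis q_def order_antisym)
    then show ?thesis using True by simp
  next
    case False
    define A where "A = Y -` {y} \<inter> space M"
    have A: "emeasure M A \<noteq> 0" "emeasure M A \<noteq> \<infinity>"
      using False by (auto simp: A_def p_def measure_def)
    interpret U: information_space "uniform_measure M A" b
      using prob_space_uniform_measure[OF A] b_gt_1
      by (simp add: information_space_def information_space_axioms_def)
    have m: "measure (uniform_measure M A) (Z -` {z} \<inter> space M) = q (z, y) / p y" for z
    proof -
      have "A \<inter> (Z -` {z} \<inter> space M) = (\<lambda>\<omega>. (Z \<omega>, Y \<omega>)) -` {(z, y)} \<inter> space M"
        by (auto simp: A_def)
      then show ?thesis
        using measure_uniform_measure[OF A simple_functionD(2)[OF Z]]
        by (simp add: q_def p_def A_def)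
    qed
    have "h y = - (\<Sum>z\<in>Z ` space M. q (z, y) / p y * log b (q (z, y) / p y))"
      using U.entropy_sum[of Z] Z by (simp add: h_def m flip: A_def)
    then show ?thesis
      using False by (simp add: sum_distrib_left)
  qed
  have "\<H>(Z | Y) =
      - (\<Sum>(z, y)\<in>(\<lambda>\<omega>. (Z \<omega>, Y \<omega>)) ` space M. q (z, y) * log b (q (z, y) / p y))"
    unfolding p_def q_def
    by (rule conditional_entropy_eq[OF simple_distributedI[OF Y measure_nonneg refl]
          simple_distributedI[OF ZY measure_nonneg refl]])
  \<comment> \<open>The range of the pair may be smaller than the product of the ranges; the added
    pairs have empty preimage, hence \<open>q = 0\<close>. On the full product the sum splits into
    one inner sum per \<open>y\<close>.\<close>
  also have "\<dots> = - (\<Sum>(z, y)\<in>Z ` space M \<times> Y ` space M. q (z, y) * log b (q (z, y) / p y))"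
  proof -
    have "q (z, y) = 0" if "(z, y) \<notin> (\<lambda>\<omega>. (Z \<omega>, Y \<omega>)) ` space M" for z y
    proof -
      have "(\<lambda>\<omega>. (Z \<omega>, Y \<omega>)) -` {(z, y)} \<inter> space M = {}" using that by auto
      then show ?thesis by (simp only: q_def measure_empty)
    qed
    then show ?thesis
      using simple_functionD(1)[OF Z] simple_functionD(1)[OF Y]
      by (intro arg_cong[of _ _ uminus] sum.mono_neutral_left) auto
  qed
  also have "\<dots> = (\<Sum>y\<in>Y ` space M. - (\<Sum>z\<in>Z ` space M. q (z, y) * log b (q (z, y) / p y)))"
    by (subst sum.cartesian_product[symmetric], subst sum.swap) (simp add: sum_negf)
  also have "\<dots> = (\<Sum>y\<in>Y ` space M. p y * h y)"
    by (intro sum.cong refl) (simp add: fibre)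
  finally show ?thesis by (simp add: p_def h_def)
qed

text \<open>O-information is a linear combination of entropies, so averaging it over
  \<open>y\<close> averages each entropy separately.\<close>

lemma (in information_space) cond_o_information_eq:
  assumes X: "\<And>j. j \<in> {1..n} \<Longrightarrow> simple_function M (X j)" and Y: "simple_function M Y"
  shows "cond_o_information b M n X Y =
    (real n - 2) * \<H>(subvector {1..n} X | Y) +
    (\<Sum>j=1..n. \<H>(X j | Y) - \<H>(subvector ({1..n} - {j}) X | Y))"
proof -
  define p where "p y = prob (Y -` {y} \<inter> space M)" for y
  \<comment> \<open>\<open>h\<close> and \<open>g\<close> are the same quantity at two types, for
    subvectors and for single components: a local definition is monomorphic.\<close>
  define h :: "('a \<Rightarrow> nat \<Rightarrow> 'b) \<Rightarrow> 'c \<Rightarrow> real" where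
    "h Z y = shannon_entropy b (uniform_measure M (Y -` {y} \<inter> space M)) Z" for Z y
  define g :: "('a \<Rightarrow> 'b) \<Rightarrow> 'c \<Rightarrow> real" where
    "g Z y = shannon_entropy b (uniform_measure M (Y -` {y} \<inter> space M)) Z" for Z y
  have sv: "simple_function M (subvector J X)" if "J \<subseteq> {1..n}" for J
    using that X by (intro simple_function_subvector) (auto intro: finite_subset)
  have H: "\<H>(subvector J X | Y) = (\<Sum>y\<in>Y ` space M. p y * h (subvector J X) y)"
    if "J \<subseteq> {1..n}" for J
    using conditional_entropy_eq_average[OF sv[OF that] Y] by (simp add: p_def h_def)
  have G: "\<H>(X j | Y) = (\<Sum>y\<in>Y ` space M. p y * g (X j) y)" if "j \<in> {1..n}" for j
    using conditional_entropy_eq_average[OF X[OF that] Y] by (simp add: p_def g_def)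
  have "cond_o_information b M n X Y =
      (\<Sum>y\<in>Y ` space M. p y * ((real n - 2) * h (subvector {1..n} X) y +
        (\<Sum>j=1..n. g (X j) y - h (subvector ({1..n} - {j}) X) y)))"
    by (simp add: cond_o_information_def o_information_def p_def h_def g_def)
  also have "\<dots> = (real n - 2) * (\<Sum>y\<in>Y ` space M. p y * h (subvector {1..n} X) y) +
      (\<Sum>y\<in>Y ` space M. \<Sum>j=1..n. p y * g (X j) y - p y * h (subvector ({1..n} - {j}) X) y)"
    by (simp add: distrib_left sum.distrib sum_distrib_left right_diff_distrib mult.left_commute)
  also have "\<dots> = (real n - 2) * \<H>(subvector {1..n} X | Y) +
      (\<Sum>j=1..n. \<H>(X j | Y) - \<H>(subvector ({1..n} - {j}) X | Y))"
    by (subst sum.swap) (simp add: H G sum_subtractf Diff_subset)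
  finally show ?thesis .
qed

text \<open>The extended vector is the image of the pair \<open>(Y, subvector J X)\<close> under
  writing \<open>y\<close> at position \<open>i\<close>. This map is injective on the range of the
  pair, so the entropy is that of the pair, and the chain rule applies.\<close>

lemma (in information_space) entropy_subvector_insert:
  assumes "finite J" "i \<notin> J"
    and X: "\<And>j. j \<in> J \<Longrightarrow> simple_function M (X j)" and Y: "simple_function M Y"
  shows "\<H>(subvector (insert i J) (X(i := Y))) = \<H>(Y) + \<H>(subvector J X | Y)"
proof -
  let ?f = "\<lambda>(y, v). v(i := y)" and ?YX = "\<lambda>\<omega>. (Y \<omega>, subvector J X \<omega>)"
  have sv: "simple_function M (subvector J X)"
    using assms by (intro simple_function_subvector)
  have "inj_on ?f (?YX ` space M)"
  proof (rule inj_onI)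
    fix s t assume "s \<in> ?YX ` space M" "t \<in> ?YX ` space M" and eq: "?f s = ?f t"
    \<comment> \<open>Equality of the updates says nothing about \<open>v i\<close> and
      \<open>w i\<close>; these agree because restriction to \<open>J\<close> puts the default
      \<open>undefined\<close> at \<open>i \<notin> J\<close>.\<close>
    then obtain v w where st: "s = (fst s, v)" "t = (fst t, w)"
      and out: "v i = undefined" "w i = undefined"
      using \<open>i \<notin> J\<close> by (auto simp: subvector_def)
    have upd: "v(i := fst s) = w(i := fst t)"
      using eq st by (metis case_prod_conv)
    have "v = w"
    proof
      fix k
      show "v k = w k"
        using fun_cong[OF upd, of k] out by (cases "k = i") auto
    qed
    moreover have "fst s = fst t"
      using fun_cong[OF upd, of i] by simp
    ultimately show "s = t" using st by metis
  qed
  then have "\<H>(?f \<circ> ?YX) = \<H>(?YX)"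
    by (intro entropy_of_inj simple_function_Pair Y sv)
  moreover have "?f \<circ> ?YX = subvector (insert i J) (X(i := Y))"
    using \<open>i \<notin> J\<close> by (auto simp: subvector_def fun_eq_iff restrict_def)
  ultimately show ?thesis
    using entropy_chain_rule[OF Y sv] by simp
qed

theorem proposition1:
  fixes M :: "'a measure" and b :: real and n :: nat
    and X :: "nat \<Rightarrow> 'a \<Rightarrow> 'v" and Y :: "'a \<Rightarrow> 'v"
    and \<X> :: "nat \<Rightarrow> 'v set" and \<Y> :: "'v set"
  assumes "information_space M b"
    and "n \<ge> 2"
    and "\<And>i. i \<in> {1..n} \<Longrightarrow> finite (\<X> i)"
    and "\<And>i. i \<in> {1..n} \<Longrightarrow> X i \<in> measurable M (count_space (\<X> i))"
    and "finite \<Y>"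
    and "Y \<in> measurable M (count_space \<Y>)"
  shows "rsi b M n X Y =
    o_information b M (Suc n) (X(Suc n := Y)) - cond_o_information b M n X Y"
proof -
  interpret information_space M b by fact
  have simple: "simple_function M Z" if "finite A" "Z \<in> measurable M (count_space A)"
    for Z :: "'a \<Rightarrow> 'v" and A
    using that by (auto simp: simple_function_def measurable_count_space_eq2 Pi_iff
        intro: finite_subset[of _ A])
  have X: "simple_function M (X j)" if "j \<in> {1..n}" for j
    using simple assms(3,4) that by blast
  have Y: "simple_function M Y"
    using simple assms(5,6) by blast
  have sv: "simple_function M (subvector {1..n} X)"
    using X by (intro simple_function_subvector) auto
  let ?X' = "X(Suc n := Y)"
  have joint: "\<H>(subvector (insert (Suc n) J) ?X') = \<H>(Y) + \<H>(subvector J X | Y)"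
    if "J \<subseteq> {1..n}" for J
    using that X Y by (intro entropy_subvector_insert) (auto intro: finite_subset)
  have all: "{1..Suc n} = insert (Suc n) {1..n}"
    by auto
  have del: "\<H>(subvector ({1..Suc n} - {j}) ?X') = \<H>(Y) + \<H>(subvector ({1..n} - {j}) X | Y)"
    if "j \<in> {1..n}" for j
  proof -
    have "{1..Suc n} - {j} = insert (Suc n) ({1..n} - {j})"
      using that by auto
    then show ?thesis
      using joint[OF Diff_subset[of "{1..n}" "{j}"]] by metis
  qed
  have del_last: "subvector ({1..Suc n} - {Suc n}) ?X' = subvector {1..n} X"
    by (auto simp: subvector_def fun_eq_iff restrict_def)
  \<comment> \<open>With \<open>k = n + 1\<close> the factor \<open>k - 2\<close> is
    \<open>n - 1\<close>; the summand for \<open>Y\<close>, at index \<open>Suc n\<close>, is split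
    off.\<close>
  have "o_information b M (Suc n) ?X' =
      (real n - 1) * \<H>(subvector {1..Suc n} ?X') +
      (\<Sum>j=1..n. \<H>(X j) - \<H>(subvector ({1..Suc n} - {j}) ?X')) +
      (\<H>(Y) - \<H>(subvector {1..n} X))"
    unfolding o_information_def del_last[symmetric] by simp
  \<comment> \<open>Each of the \<open>n\<close> deletions of an \<open>X j\<close> keeps
    \<open>Y\<close>, hence costs one \<open>\<H>(Y)\<close>.\<close>
  also have "(\<Sum>j=1..n. \<H>(X j) - \<H>(subvector ({1..Suc n} - {j}) ?X')) =
      (\<Sum>j=1..n. \<H>(X j) - \<H>(subvector ({1..n} - {j}) X | Y)) - real n * \<H>(Y)"
  proof -
    have "(\<Sum>j=1..n. \<H>(X j) - \<H>(subvector ({1..Suc n} - {j}) ?X')) =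
        (\<Sum>j=1..n. \<H>(X j) - \<H>(subvector ({1..n} - {j}) X | Y) - \<H>(Y))"
      by (rule sum.cong[OF refl], subst del) simp_all
    then show ?thesis by (simp add: sum_subtractf)
  qed
  also have "\<H>(subvector {1..Suc n} ?X') = \<H>(Y) + \<H>(subvector {1..n} X | Y)"
    unfolding all by (rule joint) simp
  \<comment> \<open>The total coefficient of \<open>\<H>(Y)\<close> is
    \<open>(n - 1) - n + 1 = 0\<close>.\<close>
  finally have o_joint: "o_information b M (Suc n) ?X' =
      (real n - 1) * \<H>(subvector {1..n} X | Y) - \<H>(subvector {1..n} X) +
      (\<Sum>j=1..n. \<H>(X j) - \<H>(subvector ({1..n} - {j}) X | Y))"
    by argo
  have "rsi b M n X Y =
      (\<Sum>j=1..n. \<H>(X j) - \<H>(X j | Y)) - (\<H>(subvector {1..n} X) - \<H>(subvector {1..n} X | Y))"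
    unfolding rsi_def mutual_information_eq_entropy_conditional_entropy[OF sv Y]
    by (simp add: mutual_information_eq_entropy_conditional_entropy[OF X Y])
  moreover have "cond_o_information b M n X Y =
      (real n - 2) * \<H>(subvector {1..n} X | Y) +
      (\<Sum>j=1..n. \<H>(X j | Y) - \<H>(subvector ({1..n} - {j}) X | Y))"
    using X Y by (rule cond_o_information_eq)
  \<comment> \<open>In the difference the deleted-vector terms cancel, and
    \<open>(n - 1) - (n - 2) = 1\<close> copy of \<open>\<H>(subvector {1..n} X | Y)\<close>
    remains, as in the mutual information of the whole vector with \<open>Y\<close>.\<close>
  ultimately show ?thesis
    unfolding o_joint
    by (simp add: sum_subtractf algebra_simps)
qed

end
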